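(* For any $a,b\in\{1,2\}$ and $(i,j),(k,l)\in\mathbb{Z}^2$, the convolution product $\chi^{(a)}_{i,j}*\chi^{(b)}_{k,l}$ yields a well-defined function of one of the following types: $\sum_{r\le n}c_r\chi^{(e)}_{r,s}$ with $s>0$; $\sum_{r\ge n}c_r\chi^{(e)}_{r,s}$ with $s<0$; or $\sum_{n\le r\le n'}c_r\chi^{(e)}_{r,0}$, where $n,n',s\in\mathbb{Z}$, $e=1,2$ and $c_r\in\mathbb{C}$.
   Context: $F$ is a two-dimensional local field with last residue field $F_0=\mathbb{F}_q$, and $v:F^\times\to\mathbb{Z}^2$ is a fixed discrete valuation of rank two, where $\mathbb{Z}^2$ carries the lexicographic order from the right: $(i,j)<(k,l)$ iff $j<l$, or $j=l$ and $i<k$. $t_1,t_2$ are local parameters, with $v(t_1)=(1,0)$, $v(t_2)=(0,1)$. $O=\{x\in F: x=0 \text{ or } v(x)\ge(0,0)\}$, with $O/t_1O=\mathbb{F}_q$. $G=SL_2(F)$, and $I=\left\{\begin{pmatrix} a&b\\c&d\end{pmatrix}\in SL_2(O): c\in t_1O\right\}$. For $(i,j)\in\mathbb{Z}^2$ set $\eta^{(1)}_{i,j}=\begin{pmatrix} t_1^i t_2^j & 0\\ 0 & t_1^{-i}t_2^{-j}\end{pmatrix}$, $\eta^{(2)}_{i,j}=\begin{pmatrix} 0 & t_1^i t_2^j\\ -t_1^{-i}t_2^{-j} & 0\end{pmatrix}$, and $C^{(a)}_{i,j}=I\eta^{(a)}_{i,j}I$. By the (known) Bruhat decomposition, $G$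 is the disjoint union of all the $C^{(a)}_{i,j}$, $a\in\{1,2\}$, $(i,j)\in\mathbb{Z}^2$. Let $\eta$ be the map on $G$ with $\eta(x)=\eta^{(a)}_{i,j}$ for $x\in C^{(a)}_{i,j}$. Let $\chi^{(a)}_{i,j}$ be the characteristic function of $C^{(a)}_{i,j}$, and $C_j=\bigcup_{m\in\mathbb{Z}}(C^{(1)}_{m,j}\cup C^{(2)}_{m,j})$. The convolution product is defined by $$(\chi^{(a)}_{i,j}*\chi^{(b)}_{k,l})(x)=\begin{cases} q^{-1}\sum_z \chi^{(a)}_{i,j}(\eta(x)z^{-1}) & \text{if } x\in C_{j+l}\text{ and } jl\ge0,\\ 0 & \text{otherwise,}\end{cases}$$ where $z$ runs over a set of representatives of the decomposition $C^{(b)}_{k,l}=\coprod_z Iz$ into right cosets of $I$. This is in general an uncountable union, so it has to be proved that the product is well-defined, i.e. that for every $x\in G$ the sum defining its value at $x$ has only finitely many nonzero terms.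
   Formalization: The sums run over r and over both e=1,2, with coefficients depending on e and r; with a single fixed e the claim is false, since χ^(2)_{0,0}*χ^(2)_{0,0} = χ^(1)_{0,0} + ((q-1)/q) χ^(2)_{0,0}. *)

theory Defs
  imports "HOL-Analysis.Analysis" "HOL-Algebra.Algebraic_Closure_Type"
begin

text \<open>
  Valuations are total functions; their value at zero is unspecified, and the usual convention
  that zero has infinite valuation is spelt out as the alternative \<open>x = 0\<close> where it matters.
\<close>

definition val_ring :: "('a, 'b) ring_scheme \<Rightarrow> ('a \<Rightarrow> int) \<Rightarrow> ('a, 'b) ring_scheme"
  where "val_ring R w = R\<lparr>carrier := {x \<in> carrier R. x = \<zero>\<^bsub>R\<^esub> \<or> 0 \<le> w x}\<rparr>"

definition val_ideal :: "('a, 'b) ring_scheme \<Rightarrow> ('a \<Rightarrow> int) \<Rightarrow> 'a set"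
  where "val_ideal R w = {x \<in> carrier R. x = \<zero>\<^bsub>R\<^esub> \<or> 0 < w x}"

definition residue_field :: "('a, 'b) ring_scheme \<Rightarrow> ('a \<Rightarrow> int) \<Rightarrow> 'a set ring"
  where "residue_field R w = val_ring R w Quot val_ideal R w"

definition residue_class :: "('a, 'b) ring_scheme \<Rightarrow> ('a \<Rightarrow> int) \<Rightarrow> 'a \<Rightarrow> 'a set"
  where "residue_class R w x = val_ideal R w +>\<^bsub>val_ring R w\<^esub> x"

definition val_close :: "('a, 'b) ring_scheme \<Rightarrow> ('a \<Rightarrow> int) \<Rightarrow> int \<Rightarrow> 'a \<Rightarrow> 'a \<Rightarrow> bool"
  where "val_close R w N x y \<longleftrightarrow> x = y \<or> N \<le> w (x \<ominus>\<^bsub>R\<^esub> y)"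

locale discrete_valuation_field = field R for R (structure) +
  fixes w :: "'a \<Rightarrow> int"
  assumes val_surj: "w ` (carrier R - {\<zero>}) = UNIV"
    and val_mult: "\<lbrakk>x \<in> carrier R - {\<zero>}; y \<in> carrier R - {\<zero>}\<rbrakk> \<Longrightarrow> w (x \<otimes> y) = w x + w y"
    and val_add: "\<lbrakk>x \<in> carrier R - {\<zero>}; y \<in> carrier R - {\<zero>}; x \<oplus> y \<noteq> \<zero>\<rbrakk>
      \<Longrightarrow> min (w x) (w y) \<le> w (x \<oplus> y)"

locale complete_discrete_valuation_field = discrete_valuation_field +
  assumes val_complete:
    "\<lbrakk>\<And>n. f n \<in> carrier R; \<And>N. \<exists>M. \<forall>m\<ge>M. \<forall>n\<ge>M. val_close R w N (f m) (f n)\<rbrakk>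
      \<Longrightarrow> \<exists>x\<in>carrier R. \<forall>N. \<exists>M. \<forall>n\<ge>M. val_close R w N (f (n::nat)) x"

text \<open>The lexicographic order from the right, written out because the order that the library
  puts on pairs is the componentwise one.\<close>

definition rlex_less :: "int \<times> int \<Rightarrow> int \<times> int \<Rightarrow> bool"
  where "rlex_less p p' \<longleftrightarrow> snd p < snd p' \<or> (snd p = snd p' \<and> fst p < fst p')"

definition rlex_le :: "int \<times> int \<Rightarrow> int \<times> int \<Rightarrow> bool"
  where "rlex_le p p' \<longleftrightarrow> rlex_less p p' \<or> p = p'"

definition rank_two_valuation :: "('a::field \<Rightarrow> int \<times> int) \<Rightarrow> bool"
  where "rank_two_valuation v \<longleftrightarrow>
    v ` (UNIV - {0}) = UNIV \<and>
    (\<forall>x y. x \<noteq> 0 \<longrightarrow> y \<noteq> 0 \<longrightarrow> v (x * y) = v x + v y) \<and>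
    (\<forall>x y. x \<noteq> 0 \<longrightarrow> y \<noteq> 0 \<longrightarrow> x + y \<noteq> 0 \<longrightarrow>
       rlex_le (v x) (v (x + y)) \<or> rlex_le (v y) (v (x + y)))"

text \<open>
  The field \<open>F\<close> is the whole type \<open>'a\<close>.  The last two assumptions say that the rank two valuation
  \<open>v\<close> is composed of \<open>w2\<close> and the valuation \<open>w1\<close> of the first residue field.
\<close>

locale two_dim_local_field =
  fixes v :: "'a::field \<Rightarrow> int \<times> int"
    and w2 :: "'a \<Rightarrow> int"
    and w1 :: "'a set \<Rightarrow> int"
    and q :: nat
  assumes complete2: "complete_discrete_valuation_field (ring_of_type_algebra :: 'a ring) w2"
    and complete1: "complete_discrete_valuation_field (residue_field ring_of_type_algebra w2) w1"
    and finite_last: "finite (carrier (residue_field (residue_field ring_of_type_algebra w2) w1))"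
    and card_last: "card (carrier (residue_field (residue_field ring_of_type_algebra w2) w1)) = q"
    and rank_two: "rank_two_valuation v"
    and snd_v: "x \<noteq> 0 \<Longrightarrow> snd (v x) = w2 x"
    and fst_v: "\<lbrakk>x \<noteq> 0; w2 x = 0\<rbrakk> \<Longrightarrow> fst (v x) = w1 (residue_class ring_of_type_algebra w2 x)"

definition integers :: "('a::field \<Rightarrow> int \<times> int) \<Rightarrow> 'a set"
  where "integers v = {x. x = 0 \<or> rlex_le (0, 0) (v x)}"

definition SL2 :: "('a::field ^ 2 ^ 2) set"
  where "SL2 = {g. det g = 1}"

definition mat2 :: "'a::field \<Rightarrow> 'a \<Rightarrow> 'a \<Rightarrow> 'a \<Rightarrow> 'a ^ 2 ^ 2"
  where "mat2 a b c d = vector [vector [a, b], vector [c, d]]"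

definition iwahori :: "('a::field \<Rightarrow> int \<times> int) \<Rightarrow> 'a \<Rightarrow> ('a ^ 2 ^ 2) set"
  where "iwahori v t1 = {g \<in> SL2. (\<forall>m n. g $ m $ n \<in> integers v) \<and> g $ 2 $ 1 \<in> (*) t1 ` integers v}"

text \<open>The upper index of \<open>\<eta>\<close>, \<open>C\<close> and \<open>\<chi>\<close> is a natural number meant to be 1 or 2.\<close>

definition eta :: "'a::field \<Rightarrow> 'a \<Rightarrow> nat \<Rightarrow> int \<Rightarrow> int \<Rightarrow> 'a ^ 2 ^ 2"
  where "eta t1 t2 a i j =
    (if a = 1 then mat2 (t1 powi i * t2 powi j) 0 0 (t1 powi (- i) * t2 powi (- j))
     else mat2 0 (t1 powi i * t2 powi j) (- (t1 powi (- i) * t2 powi (- j))) 0)"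

definition cell :: "('a::field \<Rightarrow> int \<times> int) \<Rightarrow> 'a \<Rightarrow> 'a \<Rightarrow> nat \<Rightarrow> int \<Rightarrow> int \<Rightarrow> ('a ^ 2 ^ 2) set"
  where "cell v t1 t2 a i j =
    {g ** eta t1 t2 a i j ** h | g h. g \<in> iwahori v t1 \<and> h \<in> iwahori v t1}"

definition level :: "('a::field \<Rightarrow> int \<times> int) \<Rightarrow> 'a \<Rightarrow> 'a \<Rightarrow> int \<Rightarrow> ('a ^ 2 ^ 2) set"
  where "level v t1 t2 j = (\<Union>m. cell v t1 t2 1 m j \<union> cell v t1 t2 2 m j)"

definition chi :: "('a::field \<Rightarrow> int \<times> int) \<Rightarrow> 'a \<Rightarrow> 'a \<Rightarrow> nat \<Rightarrow> int \<Rightarrow> int \<Rightarrow> 'a ^ 2 ^ 2 \<Rightarrow> complex"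
  where "chi v t1 t2 a i j = indicator (cell v t1 t2 a i j)"

text \<open>The map \<open>\<eta>\<close> on the group; the description is unique by the Bruhat decomposition.\<close>

definition eta_of :: "('a::field \<Rightarrow> int \<times> int) \<Rightarrow> 'a \<Rightarrow> 'a \<Rightarrow> 'a ^ 2 ^ 2 \<Rightarrow> 'a ^ 2 ^ 2"
  where "eta_of v t1 t2 x =
    (THE y. \<exists>a\<in>{1, 2}. \<exists>i j. x \<in> cell v t1 t2 a i j \<and> y = eta t1 t2 a i j)"

definition right_coset :: "('a::field \<Rightarrow> int \<times> int) \<Rightarrow> 'a \<Rightarrow> 'a ^ 2 ^ 2 \<Rightarrow> ('a ^ 2 ^ 2) set"
  where "right_coset v t1 z = (\<lambda>g. g ** z) ` iwahori v t1"

definition coset_reps ::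
  "('a::field \<Rightarrow> int \<times> int) \<Rightarrow> 'a \<Rightarrow> ('a ^ 2 ^ 2) set \<Rightarrow> ('a ^ 2 ^ 2) set \<Rightarrow> bool"
  where "coset_reps v t1 C Z \<longleftrightarrow>
    C = (\<Union>z\<in>Z. right_coset v t1 z) \<and>
    (\<forall>z\<in>Z. \<forall>z'\<in>Z. z \<noteq> z' \<longrightarrow> right_coset v t1 z \<inter> right_coset v t1 z' = {})"

text \<open>
  The convolution formed with the system \<open>Z\<close> of representatives.  The summands are 0 or 1, so the
  unordered sum is the sum of the nonzero terms if these are finitely many.  That they are is
  not built into the definition.
\<close>

definition convolution_wrt ::
  "('a::field \<Rightarrow> int \<times> int) \<Rightarrow> 'a \<Rightarrow> 'a \<Rightarrow> nat \<Rightarrow>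
    nat \<Rightarrow> int \<Rightarrow> int \<Rightarrow> nat \<Rightarrow> int \<Rightarrow> int \<Rightarrow> ('a ^ 2 ^ 2) set \<Rightarrow> 'a ^ 2 ^ 2 \<Rightarrow> complex"
  where "convolution_wrt v t1 t2 q a i j b k l Z x =
    (if x \<in> level v t1 t2 (j + l) \<and> 0 \<le> j * l
     then inverse (of_nat q) *
       (\<Sum>\<^sub>\<infinity>z\<in>Z. chi v t1 t2 a i j (eta_of v t1 t2 x ** matrix_inv z))
     else 0)"

definition convolution ::
  "('a::field \<Rightarrow> int \<times> int) \<Rightarrow> 'a \<Rightarrow> 'a \<Rightarrow> nat \<Rightarrow>
    nat \<Rightarrow> int \<Rightarrow> int \<Rightarrow> nat \<Rightarrow> int \<Rightarrow> int \<Rightarrow> 'a ^ 2 ^ 2 \<Rightarrow> complex"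
  where "convolution v t1 t2 q a i j b k l =
    convolution_wrt v t1 t2 q a i j b k l (SOME Z. coset_reps v t1 (cell v t1 t2 b k l) Z)"

end

theory Submission
  imports Defs
begin

text \<open>
  The order of \<open>v\<close> compares second components first; call the second component the level.  Write
  \<open>I\<close> for the Iwahori subgroup and \<open>Q\<close> and \<open>T\<close> for the monomials in \<open>\<eta>\<^sub>x = \<eta>(x)\<close> and \<open>\<eta>\<^sub>\<kappa> = \<eta>\<^sup>(\<^sup>b\<^sup>)\<^sub>k\<^sub>l\<close>.
  Everything follows from bounds on matrix entries, that is, from asking which fractional ideal
  \<open>t\<^sub>1\<^sup>m t\<^sub>2\<^sup>n O\<close> contains them.

  \<^emph>\<open>Range of the coefficients.\<close>  The entries of an element of \<open>C\<^sub>i\<^sub>j\<close> have value at least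
  \<open>(-|i|, -|j|)\<close>, because those of \<open>\<eta>\<^sub>i\<^sub>j\<close> do and \<open>I\<close> has integral entries.  If the value of the
  convolution at \<open>\<eta>\<^sub>x\<close> is nonzero, \<open>\<eta>\<^sub>x\<close> is a product of an element of \<open>C\<^sub>i\<^sub>j\<close> and one of \<open>C\<^sub>k\<^sub>l\<close>, so
  both \<open>Q\<close> and \<open>Q\<^sup>-\<^sup>1\<close> have value at least \<open>(-|i|-|k|, -|j|-|l|)\<close>.  As \<open>jl \<ge> 0\<close>, the level of \<open>Q\<close> is
  \<open>\<plusminus>(|j|+|l|)\<close>: at one of \<open>Q\<close> and \<open>Q\<^sup>-\<^sup>1\<close> the level bound is attained, and the bound on the first
  component then limits \<open>r\<close> from above, from below, or, at level zero, from both sides.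

  \<^emph>\<open>Finiteness.\<close>  Let \<open>z = g \<eta>\<^sub>\<kappa> h\<close> with \<open>g, h \<in> I\<close> contribute to the value at \<open>\<eta>\<^sub>x\<close>.  For
  \<open>l \<noteq> 0\<close> infinitely many cosets \<open>Iz\<close> make up \<open>C\<^sub>k\<^sub>l\<close>, because one entry of
  \<open>\<eta>\<^sub>\<kappa> h \<eta>\<^sub>\<kappa>\<^sup>-\<^sup>1\<close> may have a negative level.  That entry is an off-diagonal entry of \<open>h\<close> times
  \<open>T\<^sup>2\<close> or \<open>T\<^sup>-\<^sup>2\<close>.  When \<open>\<eta>\<^sub>x\<close> and \<open>\<eta>\<^sub>\<kappa>\<close> have the same shape, the same entry of \<open>h\<close> occurs with
  the factor \<open>QT\<close> or \<open>(QT)\<^sup>-\<^sup>1\<close> in \<open>\<eta>\<^sub>x (\<eta>\<^sub>\<kappa> h)\<^sup>-\<^sup>1\<close>, which like \<open>\<eta>\<^sub>x z\<^sup>-\<^sup>1\<close> lies in \<open>C\<^sub>i\<^sub>j\<close>.  Since the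
  level of \<open>Q\<close> is \<open>j + l\<close> and \<open>jl \<ge> 0\<close>, the entry bound for \<open>C\<^sub>i\<^sub>j\<close>, at level \<open>-|j|\<close>, becomes a
  bound at level exactly zero for \<open>\<eta>\<^sub>\<kappa> h \<eta>\<^sub>\<kappa>\<^sup>-\<^sup>1\<close>.  When the shapes differ, units take the place of these
  entries of \<open>h\<close>, which forces \<open>l = 0\<close>; then \<open>T\<close> has level zero, and so nothing is to be shown about
  levels (lemma \<open>conjugate_entries_bounded\<close>).  So all contributing \<open>z\<close> lie in \<open>B \<eta>\<^sub>\<kappa>\<close>, where \<open>B\<close>
  is the set of matrices in \<open>SL\<^sub>2\<close> with entries in \<open>t\<^sub>1\<^sup>-\<^sup>N O\<close>.  Two elements of \<open>B\<close> that are
  congruent modulo \<open>t\<^sub>1\<^sup>N\<^sup>+\<^sup>1 O\<close> lie in the same coset of \<open>I\<close>, and \<open>t\<^sub>1\<^sup>-\<^sup>N O / t\<^sub>1\<^sup>N\<^sup>+\<^sup>1 O\<close> is finite because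
  the last residue field is, so \<open>B\<close> meets only finitely many cosets
  (lemma \<open>finite_if_entries_bounded\<close>).

  Different systems of representatives give the same sum because the summand is constant on each
  coset \<open>Iz\<close>.
\<close>

section \<open>Fractional ideals of a rank two valuation\<close>

locale rank_two_valued_field =
  fixes v :: "'a::field \<Rightarrow> int \<times> int"
  assumes rank_two_v: "rank_two_valuation v"
begin

lemma v_mult: "x \<noteq> 0 \<Longrightarrow> y \<noteq> 0 \<Longrightarrow> v (x * y) = v x + v y"
  using rank_two_v by (simp add: rank_two_valuation_def)

lemma v_add: "x \<noteq> 0 \<Longrightarrow> y \<noteq> 0 \<Longrightarrow> x + y \<noteq> 0 \<Longrightarrow>
    rlex_le (v x) (v (x + y)) \<or> rlex_le (v y) (v (x + y))"
  using rank_two_v by (simp add: rank_two_valuation_def)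

lemma v_one [simp]: "v 1 = (0, 0)"
  using v_mult[of 1 1] by (simp add: prod_eq_iff)

lemma v_minus [simp]: "v (- x) = v x"
proof (cases "x = 0")
  case False
  have "v (-1) + v (-1) = (0, 0)"
    using v_mult[of "-1" "-1"] by simp
  hence "v (-1) = (0, 0)"
    by (simp add: prod_eq_iff)
  thus ?thesis
    using v_mult[of "-1" x] False by (simp add: prod_eq_iff)
qed simp

text \<open>
  With \<open>v t\<^sub>1 = (1, 0)\<close> and \<open>v t\<^sub>2 = (0, 1)\<close> this is the principal fractional ideal
  \<open>t\<^sub>1\<^sup>m t\<^sub>2\<^sup>n O\<close>.
\<close>

definition frac_ideal :: "int \<Rightarrow> int \<Rightarrow> 'a set"
  where "frac_ideal m n = {x. x = 0 \<or> rlex_le (m, n) (v x)}"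

lemma mem_frac_ideal:
  "x \<in> frac_ideal m n \<longleftrightarrow> x = 0 \<or> n < snd (v x) \<or> (n = snd (v x) \<and> m \<le> fst (v x))"
  by (cases "v x") (auto simp: frac_ideal_def rlex_le_def rlex_less_def)

lemma integers_eq: "integers v = frac_ideal 0 0"
  by (simp add: integers_def frac_ideal_def)

lemma frac_zero [simp, intro]: "0 \<in> frac_ideal m n"
  by (simp add: frac_ideal_def)

lemma frac_uminus [simp]: "- x \<in> frac_ideal m n \<longleftrightarrow> x \<in> frac_ideal m n"
  by (simp add: frac_ideal_def)

lemma frac_add [intro]:
  assumes "x \<in> frac_ideal m n" "y \<in> frac_ideal m n"
  shows "x + y \<in> frac_ideal m n"
proof (cases "x = 0 \<or> y = 0 \<or> x + y = 0")
  case False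
  thus ?thesis
    using assms v_add[of x y]
    by (auto simp: mem_frac_ideal rlex_le_def rlex_less_def)
qed (use assms in auto)

lemma frac_diff [intro]:
  "x \<in> frac_ideal m n \<Longrightarrow> y \<in> frac_ideal m n \<Longrightarrow> x - y \<in> frac_ideal m n"
  using frac_add[of x m n "- y"] by simp

lemma frac_mult:
  assumes "x \<in> frac_ideal m n" "y \<in> frac_ideal m' n'"
  shows "x * y \<in> frac_ideal (m + m') (n + n')"
proof (cases "x = 0 \<or> y = 0")
  case False
  thus ?thesis
    using assms v_mult[of x y] by (auto simp: mem_frac_ideal)
qed auto

lemma frac_mult_unit:
  assumes "u \<noteq> 0" "v u = (0, 0)"
  shows "x * u \<in> frac_ideal m n \<longleftrightarrow> x \<in> frac_ideal m n"
    and "u * x \<in> frac_ideal m n \<longleftrightarrow> x \<in> frac_ideal m n"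
  using assms v_mult[of x u] v_mult[of u x] by (cases "x = 0"; auto simp: mem_frac_ideal)+

lemma frac_antimono:
  "x \<in> frac_ideal m n \<Longrightarrow> n' < n \<or> (n' = n \<and> m' \<le> m) \<Longrightarrow> x \<in> frac_ideal m' n'"
  by (auto simp: mem_frac_ideal)

end

section \<open>Finiteness of the residue ring\<close>

text \<open>
  Elements of \<open>O\<close> at positive level lie in \<open>t\<^sub>1 O\<close>.  The others have a nonzero image of
  nonnegative valuation in the first residue field, hence an image in the second one, and there are finitely many such images.  If two
  images agree, their difference in the first residue field is zero or has positive valuation, and this lifts:
  the difference of the elements themselves is in \<open>t\<^sub>1 O\<close>.
\<close>

lemma (in two_dim_local_field) finite_residue:
  "\<exists>R. finite R \<and> (\<forall>x\<in>integers v. \<exists>r\<in>R. x - r = 0 \<or> rlex_le (1, 0) (v (x - r)))"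
proof -
  interpret rank_two_valued_field v
    using rank_two by unfold_locales
  define K where "K = (ring_of_type_algebra :: 'a ring)"
  define E where "E = residue_field K w2"
  define I1 where "I1 = val_ideal E w1"
  define red where "red = residue_class K w2"
  define red' where "red' = residue_class E w1"
  have red: "red x = {i + x | i. i = 0 \<or> 0 < w2 i}" for x
    by (auto simp: red_def residue_class_def val_ideal_def val_ring_def a_r_coset_def'
        K_def ring_of_type_algebra_def)
  have carrier_E: "carrier E = red ` {x. x = 0 \<or> 0 \<le> w2 x}"
    by (auto simp: E_def red_def residue_field_def FactRing_def A_RCOSETS_def'
        residue_class_def val_ring_def K_def ring_of_type_algebra_def)
  have add_E: "A \<oplus>\<^bsub>E\<^esub> B = {x + y | x y. x \<in> A \<and> y \<in> B}" for A B
    by (auto simp: E_def residue_field_def FactRing_def set_add_def'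
        val_ring_def K_def ring_of_type_algebra_def)
  have zero_E: "\<zero>\<^bsub>E\<^esub> = {i. i = 0 \<or> 0 < w2 i}"
    by (auto simp: E_def residue_field_def FactRing_def val_ideal_def K_def
        ring_of_type_algebra_def)
  interpret E: complete_discrete_valuation_field E w1
    using complete1 by (simp add: E_def K_def)
  \<comment> \<open>Positive level outweighs the first component.\<close>
  have small: "i \<in> frac_ideal 1 0" if "i = 0 \<or> 0 < w2 i" for i
    using that snd_v[of i] by (auto simp: mem_frac_ideal)
  have w1_red: "w1 (red x) = fst (v x)" if "x \<noteq> 0" "w2 x = 0" for x
    using fst_v[OF that] by (simp add: red_def K_def)
  define U where "U = {x. x \<noteq> 0 \<and> w2 x = 0 \<and> 0 \<le> fst (v x)}"
  have red_U: "red x \<in> carrier E" "\<zero>\<^bsub>E\<^esub> = red x \<or> 0 \<le> w1 (red x)" if "x \<in> U" for x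
    using that w1_red[of x] by (auto simp: carrier_E U_def)
  have fin: "finite ((red' \<circ> red) ` U)"
  proof (rule finite_subset)
    show "finite (carrier (residue_field E w1))"
      using finite_last by (simp add: E_def K_def)
    show "(red' \<circ> red) ` U \<subseteq> carrier (residue_field E w1)"
      using red_U
      by (auto simp: red'_def residue_class_def residue_field_def FactRing_def A_RCOSETS_def'
          val_ring_def)
  qed
  have sep: "x - y \<in> frac_ideal 1 0"
    if xy: "x \<in> U" "y \<in> U" and eq: "red' (red x) = red' (red y)" for x y
  proof -
    have "red x \<in> red' (red x)"
      using E.l_zero[OF red_U(1)[OF xy(1)]] E.zero_closed
      by (force simp: red'_def residue_class_def a_r_coset_def' val_ring_def val_ideal_def)
    hence "red x \<in> red' (red y)"
      using eq by simp
    then obtain h where h: "h \<in> I1" "red x = h \<oplus>\<^bsub>E\<^esub> red y"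
      by (auto simp: red'_def residue_class_def a_r_coset_def' val_ring_def I1_def)
    \<comment> \<open>The two classes differ by the class of some \<open>u\<close>; it suffices that \<open>u\<close> is in \<open>t\<^sub>1 O\<close>.\<close>
    hence h_val: "h = \<zero>\<^bsub>E\<^esub> \<or> 0 < w1 h" and "h \<in> carrier E"
      by (auto simp: I1_def val_ideal_def)
    then obtain u where u: "h = red u" "u = 0 \<or> 0 \<le> w2 u"
      by (auto simp: carrier_E)
    have "u \<in> h"
      unfolding u(1) red by auto
    have u_small: "u \<in> frac_ideal 1 0"
    proof (cases "u = 0 \<or> 0 < w2 u")
      case True
      thus ?thesis by (rule small)
    next
      case False
      with u have u0: "u \<noteq> 0" "w2 u = 0"
        by auto
      with \<open>u \<in> h\<close> zero_E have "h \<noteq> \<zero>\<^bsub>E\<^esub>"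
        by auto
      with h_val w1_red[OF u0] u(1) have "0 < fst (v u)"
        by auto
      with snd_v[OF u0(1)] u0(2) show ?thesis
        by (simp add: mem_frac_ideal)
    qed
    have "x \<in> red x"
      unfolding red by auto
    then obtain i i' where "i = 0 \<or> 0 < w2 i" "i' = 0 \<or> 0 < w2 i'"
      and x: "x = (i + u) + (i' + y)"
      using h(2) unfolding add_E u(1) red by blast
    hence "i \<in> frac_ideal 1 0" "i' \<in> frac_ideal 1 0"
      using small by auto
    hence "i + u + i' \<in> frac_ideal 1 0"
      using u_small by blast
    thus ?thesis
      using x by (simp add: algebra_simps)
  qed
  define rep where "rep = (\<lambda>c. SOME x. x \<in> U \<and> red' (red x) = c)"
  \<comment> \<open>The representative 0 serves the elements of positive level.\<close>
  define R where "R = insert 0 (rep ` (red' \<circ> red) ` U)"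
  have "\<exists>r\<in>R. x - r \<in> frac_ideal 1 0" if x: "x \<in> integers v" for x
  proof (cases "x \<in> U")
    case True
    define r where "r = rep (red' (red x))"
    have "r \<in> U \<and> red' (red r) = red' (red x)"
      unfolding r_def rep_def by (rule someI[of _ x]) (use True in auto)
    with sep True have "x - r \<in> frac_ideal 1 0"
      by metis
    moreover have "r \<in> R"
      using True by (auto simp: R_def r_def)
    ultimately show ?thesis by blast
  next
    case False
    have "x - 0 \<in> frac_ideal 1 0"
      using x False snd_v[of x] by (auto simp: integers_eq U_def mem_frac_ideal)
    thus ?thesis
      unfolding R_def by blast
  qed
  moreover have "finite R"
    using fin by (simp add: R_def)
  ultimately show ?thesis
    unfolding frac_ideal_def by blast
qed

section \<open>Two by two matrices of determinant one\<close>

lemma mat2_nth [simp]: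
  "mat2 a b c d $ 1 $ 1 = a" "mat2 a b c d $ 1 $ 2 = b"
  "mat2 a b c d $ 2 $ 1 = c" "mat2 a b c d $ 2 $ 2 = d"
  by (simp_all add: mat2_def)

lemma mat2_eq_iff: "mat2 a b c d = mat2 a' b' c' d' \<longleftrightarrow> a = a' \<and> b = b' \<and> c = c' \<and> d = d'"
  by (metis mat2_nth)

lemma mat2_entries: "mat2 (g $ 1 $ 1) (g $ 1 $ 2) (g $ 2 $ 1) (g $ 2 $ 2) = g"
  by (simp add: vec_eq_iff forall_2)

lemma mat2_cases [cases type]:
  obtains a b c d where "(g :: 'a::field ^ 2 ^ 2) = mat2 a b c d"
  using mat2_entries[of g] by metis

lemma mat2_mult:
  "mat2 a b c d ** mat2 a' b' c' d' =
     mat2 (a * a' + b * c') (a * b' + b * d') (c * a' + d * c') (c * b' + d * d')"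
  by (simp add: vec_eq_iff forall_2 matrix_matrix_mult_def sum_2)

lemma mat2_one: "mat 1 = mat2 1 0 0 1"
  by (simp add: vec_eq_iff forall_2 mat_def)

lemma mat2_in_SL2: "mat2 a b c d \<in> SL2 \<longleftrightarrow> a * d - b * c = 1"
  by (simp add: SL2_def det_2)

lemma SL2_mult: "g \<in> SL2 \<Longrightarrow> h \<in> SL2 \<Longrightarrow> g ** h \<in> SL2"
  by (simp add: SL2_def det_mul)

lemma SL2_inv:
  assumes "g \<in> SL2"
  shows "g ** matrix_inv g = mat 1" "matrix_inv g ** g = mat 1"
proof -
  have "invertible g"
    using assms by (simp add: SL2_def invertible_det_nz)
  thus "g ** matrix_inv g = mat 1" "matrix_inv g ** g = mat 1"
    by (simp_all add: invertible_def matrix_inv_def someI_ex[of "\<lambda>h. g ** h = mat 1 \<and> h ** g = mat 1"])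
qed

lemma SL2_inv_unique:
  assumes "g \<in> SL2" "g ** h = mat 1"
  shows "matrix_inv g = h"
proof -
  have "matrix_inv g ** (g ** h) = h"
    using SL2_inv[OF assms(1)] by (simp add: matrix_mul_assoc)
  thus ?thesis
    using assms(2) by simp
qed

lemma matrix_inv_mat2:
  assumes "mat2 a b c d \<in> SL2"
  shows "matrix_inv (mat2 a b c d) = mat2 d (- b) (- c) a"
  by (rule SL2_inv_unique[OF assms])
    (use assms in \<open>auto simp: mat2_mult mat2_one mat2_eq_iff mat2_in_SL2 algebra_simps\<close>)

lemma SL2_inv_closed: "g \<in> SL2 \<Longrightarrow> matrix_inv g \<in> SL2"
  by (cases g) (auto simp: matrix_inv_mat2 mat2_in_SL2 algebra_simps)

lemma SL2_cancel:
  assumes "g \<in> SL2"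
  shows "x ** g ** matrix_inv g = x" "x ** matrix_inv g ** g = x"
    "g ** (matrix_inv g ** x) = x" "matrix_inv g ** (g ** x) = x"
  using SL2_inv[OF assms] matrix_mul_assoc[of x g "matrix_inv g"]
    matrix_mul_assoc[of x "matrix_inv g" g] matrix_mul_assoc[of g "matrix_inv g" x]
    matrix_mul_assoc[of "matrix_inv g" g x] by auto

lemma SL2_inv_mult:
  assumes "g \<in> SL2" "h \<in> SL2"
  shows "matrix_inv (g ** h) = matrix_inv h ** matrix_inv g"
proof (rule SL2_inv_unique)
  show "g ** h ** (matrix_inv h ** matrix_inv g) = mat 1"
    using SL2_inv(1)[OF assms(1)] SL2_cancel(1)[OF assms(2), of g]
    by (simp add: matrix_mul_assoc)
qed (use assms in \<open>simp add: SL2_mult\<close>)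

section \<open>Monomials in the local parameters\<close>

text \<open>
  What the argument needs of a two-dimensional local field: local parameters for a rank two
  valuation, and finitely many classes of \<open>O\<close> modulo \<open>t\<^sub>1\<close>.
\<close>

locale iwahori_setting = rank_two_valued_field v
  for v :: "'a::field \<Rightarrow> int \<times> int" +
  fixes t1 t2 :: 'a
  assumes t1_nz [simp]: "t1 \<noteq> 0" and v_t1: "v t1 = (1, 0)"
    and t2_nz [simp]: "t2 \<noteq> 0" and v_t2: "v t2 = (0, 1)"
    and finite_residue_system:
      "\<exists>R. finite R \<and> (\<forall>x\<in>frac_ideal 0 0. \<exists>r\<in>R. x - r \<in> frac_ideal 1 0)"
begin

definition tpow :: "int \<Rightarrow> int \<Rightarrow> 'a"
  where "tpow i j = t1 powi i * t2 powi j"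

lemma tpow_nz [simp]: "tpow i j \<noteq> 0"
  by (simp add: tpow_def)

lemma tpow_add: "tpow i j * tpow i' j' = tpow (i + i') (j + j')"
  by (simp add: tpow_def power_int_add)

lemma tpow_zero [simp]: "tpow 0 0 = 1"
  by (simp add: tpow_def)

lemma tpow_minus: "tpow (- i) (- j) = inverse (tpow i j)"
  using tpow_add[of i j "- i" "- j"] by (simp add: inverse_unique)

lemma v_inverse: "x \<noteq> 0 \<Longrightarrow> v (inverse x) = - v x"
  using v_mult[of x "inverse x"] by (simp add: prod_eq_iff)

lemma v_power: "x \<noteq> 0 \<Longrightarrow> v (x ^ n) = (int n * fst (v x), int n * snd (v x))"
  by (induction n) (auto simp: v_mult prod_eq_iff algebra_simps)

lemma v_tpow [simp]: "v (tpow i j) = (i, j)"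
proof -
  have "v (x powi n) = (n * fst (v x), n * snd (v x))" if "x \<noteq> 0" for x n
    using that by (cases "n \<ge> 0")
      (auto simp: power_int_def v_power v_inverse power_inverse[symmetric] prod_eq_iff)
  thus ?thesis
    by (simp add: tpow_def v_mult v_t1 v_t2)
qed

lemma tpow_mem_frac: "tpow i j \<in> frac_ideal m n \<longleftrightarrow> n < j \<or> (n = j \<and> m \<le> i)"
  by (simp add: mem_frac_ideal)

lemma tpow_mult_mem_frac: "tpow i j * x \<in> frac_ideal m n \<longleftrightarrow> x \<in> frac_ideal (m - i) (n - j)"
  by (cases "x = 0") (auto simp: mem_frac_ideal v_mult)

lemma integers_t1: "(*) t1 ` integers v = frac_ideal 1 0"
proof -
  have eq: "t1 = tpow 1 0"
    by (simp add: tpow_def)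
  have "x \<in> (*) t1 ` frac_ideal 0 0" if "x \<in> frac_ideal 1 0" for x
  proof
    show "x = t1 * (x / t1)" by simp
    thus "x / t1 \<in> frac_ideal 0 0"
      using that tpow_mult_mem_frac[of 1 0 "x / t1" 1 0] eq by simp
  qed
  moreover have "t1 * y \<in> frac_ideal 1 0" if "y \<in> frac_ideal 0 0" for y
    using that tpow_mult_mem_frac[of 1 0 y 1 0] eq by simp
  ultimately show ?thesis
    by (auto simp: integers_eq)
qed

text \<open>
  Expand to \<open>n\<close> digits in powers of \<open>t\<^sub>1\<close>, each digit from the finite residue system.
\<close>

lemma finite_quotient:
  "\<exists>R. finite R \<and> (\<forall>x\<in>frac_ideal m 0. \<exists>r\<in>R. x - r \<in> frac_ideal (m + int n) 0)"
proof (induction n)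
  case 0
  show ?case
    by (rule exI[of _ "{0}"]) simp
next
  case (Suc n)
  then obtain R where R: "finite R" "\<And>x. x \<in> frac_ideal m 0 \<Longrightarrow> \<exists>r\<in>R. x - r \<in> frac_ideal (m + int n) 0"
    by blast
  obtain R0 where R0: "finite R0" "\<And>x. x \<in> frac_ideal 0 0 \<Longrightarrow> \<exists>r\<in>R0. x - r \<in> frac_ideal 1 0"
    using finite_residue_system by blast
  define T where "T = tpow (m + int n) 0"
  have "\<exists>r\<in>(\<lambda>(r, r0). r + T * r0) ` (R \<times> R0). x - r \<in> frac_ideal (m + int (Suc n)) 0"
    if x: "x \<in> frac_ideal m 0" for x
  proof -
    obtain r where r: "r \<in> R" "x - r \<in> frac_ideal (m + int n) 0"
      using R(2)[OF x] by blast
    define y where "y = (x - r) / T"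
    have xr: "x - r = T * y"
      by (simp add: y_def T_def)
    hence "y \<in> frac_ideal 0 0"
      using r(2) tpow_mult_mem_frac[of "m + int n" 0 y "m + int n" 0] by (simp add: T_def)
    then obtain r0 where r0: "r0 \<in> R0" "y - r0 \<in> frac_ideal 1 0"
      using R0(2) by blast
    have "T * (y - r0) \<in> frac_ideal (m + int (Suc n)) 0"
      using r0(2) by (simp add: T_def tpow_mult_mem_frac)
    also have "T * (y - r0) = x - (r + T * r0)"
      using xr by (simp add: algebra_simps)
    finally show ?thesis
      using r(1) r0(1) by force
  qed
  thus ?case
    using R(1) R0(1) by (intro exI[of _ "(\<lambda>(r, r0). r + T * r0) ` (R \<times> R0)"]) simp
qed

section \<open>The Iwahori subgroup and its double cosets\<close>

abbreviation Iw :: "('a ^ 2 ^ 2) set"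
  where "Iw \<equiv> iwahori v t1"

lemma mat2_in_Iw:
  "mat2 a b c d \<in> Iw \<longleftrightarrow> a * d - b * c = 1 \<and>
     a \<in> frac_ideal 0 0 \<and> b \<in> frac_ideal 0 0 \<and> c \<in> frac_ideal 1 0 \<and> d \<in> frac_ideal 0 0"
  using frac_antimono[of c 1 0 0 0]
  by (auto simp: iwahori_def mat2_in_SL2 forall_2 integers_t1[unfolded integers_eq] integers_eq)

lemma Iw_SL2: "g \<in> Iw \<Longrightarrow> g \<in> SL2"
  by (simp add: iwahori_def)

lemma Iw_one: "mat 1 \<in> Iw"
  by (simp add: mat2_one mat2_in_Iw mem_frac_ideal)

lemma Iw_mult:
  assumes "g \<in> Iw" "h \<in> Iw"
  shows "g ** h \<in> Iw"
proof -
  obtain a b c d where g: "g = mat2 a b c d" by (cases g)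
  obtain a' b' c' d' where h: "h = mat2 a' b' c' d'" by (cases h)
  have "g ** h \<in> SL2"
    using assms by (simp add: SL2_mult Iw_SL2)
  thus ?thesis
    using assms frac_mult[of a 0 0 a' 0 0] frac_mult[of a 0 0 b' 0 0] frac_mult[of b 0 0 d' 0 0]
      frac_mult[of c 1 0 a' 0 0] frac_mult[of d 0 0 c' 1 0] frac_mult[of c 1 0 b' 0 0]
      frac_mult[of d 0 0 d' 0 0] frac_mult[of b 0 0 c' 1 0]
      frac_antimono[of "b * c'" 1 0 0 0] frac_antimono[of "c * b'" 1 0 0 0]
    by (auto simp: g h mat2_mult mat2_in_Iw mat2_in_SL2)
qed

lemma Iw_inv: "g \<in> Iw \<Longrightarrow> matrix_inv g \<in> Iw"
  by (cases g) (auto simp: matrix_inv_mat2 mat2_in_Iw mat2_in_SL2 algebra_simps)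

text \<open>
  Elements of \<open>I\<close> are upper triangular modulo \<open>t\<^sub>1\<close>, so the product of the diagonal entries is
  congruent to the determinant 1.
\<close>

lemma Iw_diagonal_units:
  assumes "mat2 a b c d \<in> Iw"
  shows "a \<noteq> 0" "v a = (0, 0)" "d \<noteq> 0" "v d = (0, 0)"
proof -
  have mem: "a \<in> frac_ideal 0 0" "b \<in> frac_ideal 0 0" "c \<in> frac_ideal 1 0" "d \<in> frac_ideal 0 0"
    and det: "a * d - b * c = 1"
    using assms by (auto simp: mat2_in_Iw)
  have "b * c \<in> frac_ideal 1 0"
    using frac_mult[OF mem(2,3)] by simp
  moreover have "a * d - b * c \<notin> frac_ideal 1 0"
    unfolding det by (simp add: mem_frac_ideal)
  ultimately have "a * d \<notin> frac_ideal 1 0"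
    by blast
  hence "a \<notin> frac_ideal 1 0" "d \<notin> frac_ideal 1 0"
    using frac_mult[of a 1 0 d 0 0] frac_mult[of a 0 0 d 1 0] mem by auto
  thus "a \<noteq> 0" "v a = (0, 0)" "d \<noteq> 0" "v d = (0, 0)"
    using mem by (auto simp: mem_frac_ideal prod_eq_iff)
qed

abbreviation cl :: "nat \<Rightarrow> int \<Rightarrow> int \<Rightarrow> ('a ^ 2 ^ 2) set"
  where "cl \<equiv> cell v t1 t2"

abbreviation et :: "nat \<Rightarrow> int \<Rightarrow> int \<Rightarrow> 'a ^ 2 ^ 2"
  where "et \<equiv> eta t1 t2"

lemma eta_eq:
  "et a i j = (if a = 1 then mat2 (tpow i j) 0 0 (tpow (- i) (- j))
     else mat2 0 (tpow i j) (- tpow (- i) (- j)) 0)"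
  by (simp add: eta_def tpow_def)

lemma eta_SL2: "et a i j \<in> SL2"
  by (simp add: eta_eq mat2_in_SL2 tpow_add)

lemma cell_SL2: "x \<in> cl a i j \<Longrightarrow> x \<in> SL2"
  using Iw_SL2 eta_SL2 SL2_mult unfolding cell_def by blast

lemma eta_in_cell: "et a i j \<in> cl a i j"
  unfolding cell_def using Iw_one by force

lemma cell_mult_right:
  assumes "x \<in> cl a i j" "g \<in> Iw"
  shows "x ** g \<in> cl a i j"
  using assms Iw_mult unfolding cell_def by (force simp: matrix_mul_assoc[symmetric])

lemma cell_mult_left:
  assumes "x \<in> cl a i j" "g \<in> Iw"
  shows "g ** x \<in> cl a i j"
  using assms Iw_mult unfolding cell_def by (force simp: matrix_mul_assoc)

lemma cell_mult_right_iff: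
  assumes "g \<in> Iw"
  shows "x ** g \<in> cl a i j \<longleftrightarrow> x \<in> cl a i j"
  using cell_mult_right[OF _ assms] cell_mult_right[OF _ Iw_inv[OF assms], of "x ** g"]
  by (auto simp: SL2_cancel Iw_SL2[OF assms])

text \<open>
  Disjointness of the double cosets.  Read off the entries of \<open>g \<eta> = \<eta>' h\<close>: a diagonal entry of
  \<open>g\<close>, a unit, times the monomial of \<open>\<eta>\<close> equals an entry of \<open>h\<close> times the monomial of
  \<open>\<eta>'\<close>.  For equal shapes that entry of \<open>h\<close> is again a unit, so the monomials have the same
  value.  For different shapes it is off-diagonal; the upper right entry gives one weak inequality,
  the lower left one a strict inequality in the opposite direction.
\<close>

lemma eta_double_coset:
  assumes "a \<in> {1, 2}" "a' \<in> {1, 2}" "g \<in> Iw" "h \<in> Iw"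
    and eq: "g ** et a i j = et a' i' j' ** h"
  shows "a = a' \<and> i = i' \<and> j = j'"
proof -
  obtain p b c d where g: "g = mat2 p b c d" by (cases g)
  obtain p' b' c' d' where h: "h = mat2 p' b' c' d'" by (cases h)
  note units = Iw_diagonal_units[OF assms(3)[unfolded g]] Iw_diagonal_units[OF assms(4)[unfolded h]]
  note mem = assms(3,4)[unfolded g h mat2_in_Iw]
  have scale: "i = i' \<and> j = j'"
    if "x * tpow i j = tpow i' j' * y" "x \<noteq> 0" "v x = (0, 0)" "y \<noteq> 0" "v y = (0, 0)" for x y
    using that v_mult[of x "tpow i j"] v_mult[of "tpow i' j'" y] by auto
  show ?thesis
  proof (cases "a = a'")
    case True
    thus ?thesis
      using eq units scale[of p p'] scale[of p d'] assms(1,2)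
      by (auto simp: g h eta_eq mat2_mult mat2_eq_iff split: if_splits)
  next
    case False
    have le: "j' + n < j \<or> (j' + n = j \<and> i' + m \<le> i)"
      if "x * tpow i j = tpow i' j' * y" "x \<noteq> 0" "v x = (0, 0)" "y \<in> frac_ideal m n"
      for x y i j i' j' m n
    proof -
      have "tpow i' j' * y \<in> frac_ideal (i' + m) (j' + n)"
        using that(4) by (simp add: tpow_mult_mem_frac)
      thus ?thesis
        unfolding that(1)[symmetric] using that(2,3)
        by (simp add: frac_mult_unit tpow_mem_frac)
    qed
    from False consider "a = 1" "a' = 2" | "a = 2" "a' = 1"
      using assms(1,2) by auto
    thus ?thesis
    proof cases
      case 1
      with eq have "p * tpow i j = tpow i' j' * c'" "d * tpow (- i) (- j) = tpow (- i') (- j') * (- b')"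
        by (simp_all add: g h eta_eq mat2_mult mat2_eq_iff)
      thus ?thesis
        using le[of p i j i' j' c' 1 0] le[of d "- i" "- j" "- i'" "- j'" "- b'" 0 0] units mem
        by auto
    next
      case 2
      with eq have "p * tpow i j = tpow i' j' * b'" "d * tpow (- i) (- j) = tpow (- i') (- j') * (- c')"
        by (auto simp: g h eta_eq mat2_mult mat2_eq_iff neg_eq_iff_add_eq_0 add_eq_0_iff)
      thus ?thesis
        using le[of p i j i' j' b' 0 0] le[of d "- i" "- j" "- i'" "- j'" "- c'" 1 0] units mem
        by auto
    qed
  qed
qed

lemma cell_unique:
  assumes "x \<in> cl a i j" "x \<in> cl a' i' j'" "a \<in> {1, 2}" "a' \<in> {1, 2}"
  shows "a = a' \<and> i = i' \<and> j = j'"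
proof -
  obtain g h where x: "x = g ** et a i j ** h" and gh: "g \<in> Iw" "h \<in> Iw"
    using assms(1) by (auto simp: cell_def)
  obtain g' h' where x': "x = g' ** et a' i' j' ** h'" and gh': "g' \<in> Iw" "h' \<in> Iw"
    using assms(2) by (auto simp: cell_def)
  have "(matrix_inv g' ** g) ** et a i j = matrix_inv g' ** (x ** matrix_inv h)"
    using Iw_SL2[OF gh(2)] by (simp add: x SL2_cancel matrix_mul_assoc)
  also have "\<dots> = et a' i' j' ** (h' ** matrix_inv h)"
    using Iw_SL2[OF gh'(1)] by (simp add: x' SL2_cancel flip: matrix_mul_assoc)
  finally show ?thesis
    by (rule eta_double_coset[OF assms(3,4), rotated 2]) (use gh gh' in \<open>simp_all add: Iw_mult Iw_inv\<close>)
qed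

text \<open>
  By disjointness the definite description in \<open>eta_of\<close> has a unique solution.
\<close>

lemma eta_of_cell:
  assumes "x \<in> cl e r s" "e \<in> {1, 2}"
  shows "eta_of v t1 t2 x = et e r s"
  unfolding eta_of_def
proof (rule the_equality)
  show "y = et e r s" if "\<exists>a\<in>{1, 2}. \<exists>i j. x \<in> cl a i j \<and> y = et a i j" for y
    using that cell_unique[OF assms(1) _ assms(2)] by metis
qed (use assms in blast)

lemma mem_level: "x \<in> level v t1 t2 s \<longleftrightarrow> (\<exists>e\<in>{1, 2}. \<exists>r. x \<in> cl e r s)"
  by (auto simp: level_def)

section \<open>Bounds on matrix entries\<close>

definition entries_in :: "int \<Rightarrow> int \<Rightarrow> 'a ^ 2 ^ 2 \<Rightarrow> bool"
  where "entries_in m n g \<longleftrightarrow> (\<forall>a b. g $ a $ b \<in> frac_ideal m n)"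

lemma entries_in_mat2:
  "entries_in m n (mat2 a b c d) \<longleftrightarrow>
     a \<in> frac_ideal m n \<and> b \<in> frac_ideal m n \<and> c \<in> frac_ideal m n \<and> d \<in> frac_ideal m n"
  by (auto simp: entries_in_def forall_2)

lemma entries_in_mult:
  "entries_in m n g \<Longrightarrow> entries_in m' n' h \<Longrightarrow> entries_in (m + m') (n + n') (g ** h)"
  by (auto simp: entries_in_def matrix_matrix_mult_def sum_2 intro!: frac_add frac_mult)

lemma entries_in_Iw: "g \<in> Iw \<Longrightarrow> entries_in 0 0 g"
  by (auto simp: entries_in_def iwahori_def integers_eq)

lemma entries_in_eta: "entries_in (- \<bar>i\<bar>) (- \<bar>j\<bar>) (et a i j)"
  by (auto simp: eta_eq entries_in_mat2 tpow_mem_frac)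

lemma entries_in_cell:
  assumes "x \<in> cl a i j"
  shows "entries_in (- \<bar>i\<bar>) (- \<bar>j\<bar>) x"
proof -
  obtain g h where x: "x = g ** et a i j ** h" and gh: "g \<in> Iw" "h \<in> Iw"
    using assms by (auto simp: cell_def)
  show ?thesis
    using entries_in_mult[OF entries_in_mult[OF entries_in_Iw[OF gh(1)] entries_in_eta] entries_in_Iw[OF gh(2)]]
    by (simp add: x)
qed

text \<open>
  A contribution of \<open>z\<close> to the value at \<open>\<eta>\<close> exhibits \<open>\<eta>\<close> as the product of \<open>\<eta> z\<^sup>-\<^sup>1\<close> and
  \<open>z\<close>, and lower bounds on entries add up in a product.
\<close>

lemma eta_in_product_range:
  assumes "et e r s ** matrix_inv z \<in> cl a i j" "z \<in> cl b k l"
  shows "tpow r s \<in> frac_ideal (- \<bar>i\<bar> - \<bar>k\<bar>) (- \<bar>j\<bar> - \<bar>l\<bar>)"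
    and "tpow (- r) (- s) \<in> frac_ideal (- \<bar>i\<bar> - \<bar>k\<bar>) (- \<bar>j\<bar> - \<bar>l\<bar>)"
proof -
  have "entries_in (- \<bar>i\<bar> - \<bar>k\<bar>) (- \<bar>j\<bar> - \<bar>l\<bar>) (et e r s ** matrix_inv z ** z)"
    using entries_in_mult[OF entries_in_cell[OF assms(1)] entries_in_cell[OF assms(2)]] by simp
  hence "entries_in (- \<bar>i\<bar> - \<bar>k\<bar>) (- \<bar>j\<bar> - \<bar>l\<bar>) (et e r s)"
    by (simp add: SL2_cancel cell_SL2[OF assms(2)])
  thus "tpow r s \<in> frac_ideal (- \<bar>i\<bar> - \<bar>k\<bar>) (- \<bar>j\<bar> - \<bar>l\<bar>)"
    and "tpow (- r) (- s) \<in> frac_ideal (- \<bar>i\<bar> - \<bar>k\<bar>) (- \<bar>j\<bar> - \<bar>l\<bar>)"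
    by (auto simp: eta_eq entries_in_mat2 split: if_splits)
qed

section \<open>Finiteness of the sum\<close>

text \<open>
  Since \<open>x\<^sup>-\<^sup>1\<close> has the entries of \<open>x\<close> up to sign, \<open>y x\<^sup>-\<^sup>1 = 1 + (y - x) x\<^sup>-\<^sup>1\<close> is congruent to the
  identity modulo \<open>t\<^sub>1\<^sup>N\<^sup>+\<^sup>1 t\<^sub>1\<^sup>-\<^sup>N = t\<^sub>1\<close>.
\<close>

lemma congruent_imp_quotient_in_Iw:
  fixes x y :: "'a ^ 2 ^ 2"
  assumes "x \<in> SL2" "y \<in> SL2" "N \<ge> 0" "entries_in (- N) 0 x"
    and "\<And>a b. y $ a $ b - x $ a $ b \<in> frac_ideal (N + 1) 0"
  shows "y ** matrix_inv x \<in> Iw"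
proof -
  obtain a b c d where x: "x = mat2 a b c d" by (cases x)
  obtain a' b' c' d' where y: "y = mat2 a' b' c' d'" by (cases y)
  have det: "a * d - b * c = 1"
    using assms(1) by (simp add: x mat2_in_SL2)
  have bd: "a \<in> frac_ideal (- N) 0" "b \<in> frac_ideal (- N) 0" "c \<in> frac_ideal (- N) 0"
      "d \<in> frac_ideal (- N) 0"
    using assms(4) by (simp_all add: x entries_in_mat2)
  have df: "a' - a \<in> frac_ideal (N + 1) 0" "b' - b \<in> frac_ideal (N + 1) 0"
      "c' - c \<in> frac_ideal (N + 1) 0" "d' - d \<in> frac_ideal (N + 1) 0"
    using assms(5)[of 1 1] assms(5)[of 1 2] assms(5)[of 2 1] assms(5)[of 2 2]
    by (simp_all add: x y)
  have small: "p * q - p' * q' \<in> frac_ideal 1 0"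
    if "p \<in> frac_ideal (N + 1) 0" "q \<in> frac_ideal (- N) 0"
      "p' \<in> frac_ideal (N + 1) 0" "q' \<in> frac_ideal (- N) 0" for p q p' q'
    using frac_diff[OF frac_mult[OF that(1,2)] frac_mult[OF that(3,4)]] by simp
  have int: "p \<in> frac_ideal 0 0" if "p \<in> frac_ideal 1 0" for p
    using that by (rule frac_antimono) simp
  have int1: "p + 1 \<in> frac_ideal 0 0" if "p \<in> frac_ideal 1 0" for p
    using int[OF that] by (rule frac_add) (simp add: mem_frac_ideal)
  have e: "y ** matrix_inv x = mat2 (a' * d - b' * c) (b' * a - a' * b) (c' * d - d' * c) (d' * a - c' * b)"
    using assms(1) by (simp add: x y matrix_inv_mat2 mat2_mult mat2_eq_iff algebra_simps)
  have "a' * d - b' * c = ((a' - a) * d - (b' - b) * c) + 1"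
    "d' * a - c' * b = ((d' - d) * a - (c' - c) * b) + 1"
    "b' * a - a' * b = (b' - b) * a - (a' - a) * b"
    "c' * d - d' * c = (c' - c) * d - (d' - d) * c"
    using det by (simp_all add: algebra_simps)
  hence "a' * d - b' * c \<in> frac_ideal 0 0" "d' * a - c' * b \<in> frac_ideal 0 0"
      "b' * a - a' * b \<in> frac_ideal 0 0" "c' * d - d' * c \<in> frac_ideal 1 0"
    using int[OF small[OF df(2) bd(1) df(1) bd(2)]] small[OF df(3) bd(4) df(4) bd(3)]
      int1[OF small[OF df(1) bd(4) df(2) bd(3)]] int1[OF small[OF df(4) bd(1) df(3) bd(2)]]
    by simp_all
  moreover have "y ** matrix_inv x \<in> SL2"
    using assms(1,2) by (simp add: SL2_mult SL2_inv_closed)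
  ultimately show ?thesis
    unfolding e by (simp add: mat2_in_Iw mat2_in_SL2)
qed

text \<open>
  Pigeonhole on the residues of the four entries of \<open>z w\<close> modulo \<open>t\<^sub>1\<^sup>N\<^sup>+\<^sup>1\<close>.  The fixed
  translation by \<open>w\<close> cancels in the quotient of two elements.
\<close>

lemma finite_if_entries_bounded:
  assumes "S \<subseteq> SL2" "w \<in> SL2" "N \<ge> 0"
    and bd: "\<And>z. z \<in> S \<Longrightarrow> entries_in (- N) 0 (z ** w)"
    and sep: "\<And>z z'. z \<in> S \<Longrightarrow> z' \<in> S \<Longrightarrow> z' ** matrix_inv z \<in> Iw \<Longrightarrow> z = z'"
  shows "finite S"
proof -
  have "N + 1 = - N + int (nat (2 * N + 1))"
    using assms(3) by simp
  then obtain R where R: "finite R"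
    "\<And>x. x \<in> frac_ideal (- N) 0 \<Longrightarrow> \<exists>r\<in>R. x - r \<in> frac_ideal (N + 1) 0"
    using finite_quotient[of "- N" "nat (2 * N + 1)"] by metis
  then obtain res where res:
    "\<And>x. x \<in> frac_ideal (- N) 0 \<Longrightarrow> res x \<in> R \<and> x - res x \<in> frac_ideal (N + 1) 0"
    by metis
  have close: "y - x \<in> frac_ideal (N + 1) 0"
    if "x \<in> frac_ideal (- N) 0" "y \<in> frac_ideal (- N) 0" "res x = res y" for x y
    using frac_diff[of "y - res y" "N + 1" 0 "x - res x"] res[OF that(1)] res[OF that(2)] that(3)
    by simp
  define f where "f z = (\<lambda>(a :: 2, b :: 2). res ((z ** w) $ a $ b))" for z :: "'a ^ 2 ^ 2"
  have "inj_on f S"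
  proof (rule inj_onI)
    fix z z' assume z: "z \<in> S" "z' \<in> S" and eq: "f z = f z'"
    have "res ((z ** w) $ a $ b) = res ((z' ** w) $ a $ b)" for a b
      using fun_cong[OF eq, of "(a, b)"] by (simp add: f_def)
    hence "(z' ** w) $ a $ b - (z ** w) $ a $ b \<in> frac_ideal (N + 1) 0" for a b
      using close bd[OF z(1)] bd[OF z(2)] by (simp add: entries_in_def)
    hence "(z' ** w) ** matrix_inv (z ** w) \<in> Iw"
      using z assms(1,2,3) bd[OF z(1)]
      by (intro congruent_imp_quotient_in_Iw[of "z ** w" "z' ** w" N]) (auto intro: SL2_mult)
    also have "(z' ** w) ** matrix_inv (z ** w) = z' ** matrix_inv z"
    proof -
      have "matrix_inv (z ** w) = matrix_inv w ** matrix_inv z"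
        using z assms(1,2) by (intro SL2_inv_mult) auto
      thus ?thesis
        using SL2_cancel(1)[OF assms(2), of z'] by (simp add: matrix_mul_assoc)
    qed
    finally show "z = z'"
      using sep z by blast
  qed
  moreover have "finite (f ` S)"
  proof (rule finite_subset)
    show "f ` S \<subseteq> PiE UNIV (\<lambda>_. R)"
      using bd res by (auto simp: f_def entries_in_def)
    show "finite (PiE (UNIV :: (2 \<times> 2) set) (\<lambda>_. R))"
      using R(1) by (intro finite_PiE) auto
  qed
  ultimately show ?thesis
    by (rule finite_imageD[rotated])
qed

text \<open>
  Here \<open>\<beta>\<close> and \<open>\<gamma>\<close> are the off-diagonal entries of an element of \<open>I\<close>, in either order.  At most one of the
  two conclusions is at stake, depending on the sign of \<open>l\<close>: for \<open>l < 0\<close> the factor of \<open>\<beta>\<close> has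
  negative level \<open>2l\<close>.  But then \<open>j \<le> 0\<close>, and multiplying the assumption on \<open>\<beta>\<close> by the monomial
  of level \<open>l - s = -j\<close> turns the bound \<open>-|j| = j\<close> on the level into 0.  The case \<open>l > 0\<close> is symmetric.
\<close>

lemma offdiagonal_bound:
  assumes "s = j + l" "0 \<le> j * l" "\<beta> \<in> frac_ideal 0 0" "\<gamma> \<in> frac_ideal 0 0"
    and y12: "tpow (r + k) (s + l) * \<beta> \<in> frac_ideal (- \<bar>i\<bar>) (- \<bar>j\<bar>)"
    and y21: "tpow (- r - k) (- s - l) * \<gamma> \<in> frac_ideal (- \<bar>i\<bar>) (- \<bar>j\<bar>)"
  shows "tpow (2 * k) (2 * l) * \<beta> \<in> frac_ideal (- \<bar>i\<bar> - \<bar>r\<bar> - 2 * \<bar>k\<bar>) 0"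
    and "tpow (- 2 * k) (- 2 * l) * \<gamma> \<in> frac_ideal (- \<bar>i\<bar> - \<bar>r\<bar> - 2 * \<bar>k\<bar>) 0"
proof -
  have j: "\<bar>j\<bar> = - j" if "l < 0"
    using assms(2) that by (auto simp: zero_le_mult_iff)
  have j': "\<bar>j\<bar> = j" if "l > 0"
    using assms(2) that by (auto simp: zero_le_mult_iff)
  show "tpow (2 * k) (2 * l) * \<beta> \<in> frac_ideal (- \<bar>i\<bar> - \<bar>r\<bar> - 2 * \<bar>k\<bar>) 0"
  proof (cases "l < 0")
    case True
    show ?thesis
      using y12 assms(1) j[OF True] unfolding tpow_mult_mem_frac
      by (elim frac_antimono) auto
  next
    case False
    thus ?thesis
      using assms(3) unfolding tpow_mult_mem_frac by (elim frac_antimono) auto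
  qed
  show "tpow (- 2 * k) (- 2 * l) * \<gamma> \<in> frac_ideal (- \<bar>i\<bar> - \<bar>r\<bar> - 2 * \<bar>k\<bar>) 0"
  proof (cases "l > 0")
    case True
    show ?thesis
      using y21 assms(1) j'[OF True] unfolding tpow_mult_mem_frac
      by (elim frac_antimono) auto
  next
    case False
    thus ?thesis
      using assms(4) unfolding tpow_mult_mem_frac by (elim frac_antimono) auto
  qed
qed

text \<open>
  The levels of the two monomials are \<open>s + l = j + 2l\<close> and its negative.  As \<open>j\<close> and \<open>l\<close> do not
  have opposite signs, one of them is \<open>-|j| - 2|l|\<close>.
\<close>

lemma level_zero_of_units:
  assumes "s = j + l" "0 \<le> j * l"
    and "tpow (r + k) (s + l) \<in> frac_ideal (- \<bar>i\<bar>) (- \<bar>j\<bar>)"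
    and "tpow (- r - k) (- s - l) \<in> frac_ideal (- \<bar>i\<bar>) (- \<bar>j\<bar>)"
  shows "l = 0"
  using assms by (cases "l < 0"; cases "l > 0") (auto simp: tpow_mem_frac zero_le_mult_iff)

text \<open>
  The heart of the finiteness proof.  Let \<open>Q\<close> and \<open>T\<close> be the monomials of value \<open>(r, s)\<close> and
  \<open>(k, l)\<close>.  The diagonal entries of the conjugate are those of \<open>h\<close>, and its off-diagonal entries
  are, up to sign, \<open>T\<^sup>2\<close> times one and \<open>T\<^sup>-\<^sup>2\<close> times the other off-diagonal entry of \<open>h\<close>.  For
  \<open>e = b\<close> the matrix that lies in the cell has off-diagonal entries \<open>QT\<close> and \<open>(QT)\<^sup>-\<^sup>1\<close> times these same two
  entries of \<open>h\<close>; for \<open>e \<noteq> b\<close> they are \<open>QT\<close> and \<open>(QT)\<^sup>-\<^sup>1\<close> times units.  Finiteness rests on the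
  bound being independent of \<open>h\<close>.
\<close>

lemma conjugate_entries_bounded:
  assumes s: "s = j + l" "0 \<le> j * l" and ab: "e \<in> {1, 2}" "b \<in> {1, 2}" and h: "h \<in> Iw"
    and y: "et e r s ** matrix_inv (et b k l ** h) \<in> cl a i j"
  shows "entries_in (- \<bar>i\<bar> - \<bar>r\<bar> - 2 * \<bar>k\<bar>) 0 (et b k l ** h ** matrix_inv (et b k l))"
proof -
  obtain p \<beta> \<gamma> d where h_eq: "h = mat2 p \<beta> \<gamma> d" by (cases h)
  note units = Iw_diagonal_units[OF h[unfolded h_eq]]
  have mem: "p \<in> frac_ideal 0 0" "d \<in> frac_ideal 0 0" "\<beta> \<in> frac_ideal 0 0" "\<gamma> \<in> frac_ideal 0 0"
    using h entries_in_Iw[OF h] by (auto simp: h_eq entries_in_mat2)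
  define M where "M = - \<bar>i\<bar> - \<bar>r\<bar> - 2 * \<bar>k\<bar>"
  have diag: "p \<in> frac_ideal M 0" "d \<in> frac_ideal M 0"
    using mem(1,2) by (auto elim!: frac_antimono simp: M_def)
  have yb: "entries_in (- \<bar>i\<bar>) (- \<bar>j\<bar>) (et e r s ** (matrix_inv h ** matrix_inv (et b k l)))"
    using entries_in_cell[OF y] SL2_inv_mult[OF eta_SL2 Iw_SL2[OF h], of b k l] by simp
  define T where "T = tpow k l"
  define Q where "Q = tpow r s"
  have nz: "T \<noteq> 0" "Q \<noteq> 0"
    by (simp_all add: T_def Q_def)
  have tp: "tpow (- k) (- l) = inverse T" "tpow (- r) (- s) = inverse Q"
    "tpow (2 * k) (2 * l) = T * T" "tpow (- 2 * k) (- 2 * l) = inverse (T * T)"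
    "tpow (r + k) (s + l) = Q * T" "tpow (- r - k) (- s - l) = inverse (Q * T)"
    using tpow_minus[of k l] tpow_minus[of r s] tpow_minus[of "2 * k" "2 * l"]
      tpow_add[of k l k l] tpow_add[of r s k l] tpow_minus[of "r + k" "s + l"]
    by (simp_all add: T_def Q_def)
  have inv: "matrix_inv h = mat2 d (- \<beta>) (- \<gamma>) p"
    "matrix_inv (mat2 T 0 0 (inverse T)) = mat2 (inverse T) 0 0 T"
    "matrix_inv (mat2 0 T (- inverse T) 0) = mat2 0 (- T) (inverse T) 0"
    using Iw_SL2[OF h] nz by (simp_all add: h_eq matrix_inv_mat2 mat2_in_SL2)
  have et_b: "et b k l = (if b = 1 then mat2 T 0 0 (inverse T) else mat2 0 T (- inverse T) 0)"
    by (simp add: eta_eq tp T_def[symmetric])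
  have et_e: "et e r s = (if e = 1 then mat2 Q 0 0 (inverse Q) else mat2 0 Q (- inverse Q) 0)"
    by (simp add: eta_eq tp Q_def[symmetric])
  have conj: "et b k l ** h ** matrix_inv (et b k l) =
      (if b = 1 then mat2 p (T * T * \<beta>) (inverse (T * T) * \<gamma>) d
       else mat2 d (- (T * T * \<gamma>)) (- (inverse (T * T) * \<beta>)) p)"
    using nz by (simp add: et_b inv h_eq mat2_mult mat2_eq_iff)
  have prod: "et e r s ** (matrix_inv h ** matrix_inv (et b k l)) =
      (if b = 1 then
        (if e = 1 then mat2 (Q / T * d) (- (Q * T * \<beta>)) (- (inverse (Q * T) * \<gamma>)) (T / Q * p)
         else mat2 (- (Q / T * \<gamma>)) (Q * T * p) (- (inverse (Q * T) * d)) (T / Q * \<beta>))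
       else
        (if e = 1 then mat2 (- (Q / T * \<beta>)) (- (Q * T * d)) (inverse (Q * T) * p) (T / Q * \<gamma>)
         else mat2 (Q / T * p) (Q * T * \<gamma>) (inverse (Q * T) * \<beta>) (T / Q * d)))"
    unfolding et_b et_e inv
    by (simp add: inv mat2_mult mat2_eq_iff divide_inverse mult_ac)
  have scale: "T * T * x \<in> frac_ideal m n \<longleftrightarrow> x \<in> frac_ideal (m - 2 * k) (n - 2 * l)"
    "inverse (T * T) * x \<in> frac_ideal m n \<longleftrightarrow> x \<in> frac_ideal (m + 2 * k) (n + 2 * l)" for x m n
    using tpow_mult_mem_frac[of "2 * k" "2 * l" x m n] tpow_mult_mem_frac[of "- 2 * k" "- 2 * l" x m n]
    unfolding tp by simp_all
  have "T * T * \<beta> \<in> frac_ideal M 0 \<and> inverse (T * T) * \<gamma> \<in> frac_ideal M 0 \<and>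
      T * T * \<gamma> \<in> frac_ideal M 0 \<and> inverse (T * T) * \<beta> \<in> frac_ideal M 0"
    if "l = 0"
    using that mem(3,4) unfolding scale by (auto elim!: frac_antimono simp: M_def)
  moreover have "l = 0" if "b \<noteq> e"
    using level_zero_of_units[OF s, of r k i] yb that ab units
    unfolding prod tp by (auto simp: entries_in_mat2 frac_mult_unit split: if_splits)
  moreover have "T * T * \<beta> \<in> frac_ideal M 0 \<and> inverse (T * T) * \<gamma> \<in> frac_ideal M 0"
    if "b = 1" "e = 1"
    using offdiagonal_bound[OF s mem(3,4), of r k i] yb that
    unfolding prod tp M_def by (auto simp: entries_in_mat2)
  moreover have "T * T * \<gamma> \<in> frac_ideal M 0 \<and> inverse (T * T) * \<beta> \<in> frac_ideal M 0"
    if "b = 2" "e = 2"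
    using offdiagonal_bound[OF s mem(4,3), of r k i] yb that
    unfolding prod tp M_def by (auto simp: entries_in_mat2)
  ultimately have "entries_in M 0 (et b k l ** h ** matrix_inv (et b k l))"
    using ab diag unfolding conj by (auto simp: entries_in_mat2)
  thus ?thesis
    by (simp add: M_def)
qed

section \<open>Systems of coset representatives\<close>

lemma mem_right_coset:
  assumes "z \<in> SL2"
  shows "z' \<in> right_coset v t1 z \<longleftrightarrow> z' ** matrix_inv z \<in> Iw"
proof
  assume "z' ** matrix_inv z \<in> Iw"
  moreover have "z' = (z' ** matrix_inv z) ** z"
    by (simp add: SL2_cancel assms)
  ultimately show "z' \<in> right_coset v t1 z"
    unfolding right_coset_def by blast
next
  assume "z' \<in> right_coset v t1 z"
  thus "z' ** matrix_inv z \<in> Iw"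
    by (auto simp: right_coset_def SL2_cancel(1)[OF assms])
qed

lemma right_coset_self: "z \<in> right_coset v t1 z"
  unfolding right_coset_def using Iw_one by (intro image_eqI[of _ _ "mat 1"]) simp_all

lemma right_coset_sym:
  assumes "z' \<in> right_coset v t1 z" "z \<in> SL2"
  shows "z \<in> right_coset v t1 z'"
proof -
  obtain g where g: "g \<in> Iw" "z' = g ** z"
    using assms(1) by (auto simp: right_coset_def)
  hence "z = matrix_inv g ** z'"
    by (simp add: SL2_cancel Iw_SL2)
  thus ?thesis
    unfolding right_coset_def using Iw_inv[OF g(1)] by blast
qed

lemma right_coset_trans:
  assumes "x \<in> right_coset v t1 y" "y \<in> right_coset v t1 z"
  shows "x \<in> right_coset v t1 z"
proof -
  obtain g g' where "g \<in> Iw" "x = g ** y" "g' \<in> Iw" "y = g' ** z"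
    using assms by (auto simp: right_coset_def)
  hence "g ** g' \<in> Iw" "x = (g ** g') ** z"
    by (simp_all add: Iw_mult matrix_mul_assoc)
  thus ?thesis
    unfolding right_coset_def by blast
qed

lemma coset_reps_subset: "coset_reps v t1 C Z \<Longrightarrow> Z \<subseteq> C"
  using right_coset_self unfolding coset_reps_def by blast

lemma coset_reps_unique:
  assumes "coset_reps v t1 C Z" "z \<in> Z" "z' \<in> Z"
    "x \<in> right_coset v t1 z" "x \<in> right_coset v t1 z'"
  shows "z = z'"
proof (rule ccontr)
  assume "z \<noteq> z'"
  hence "right_coset v t1 z \<inter> right_coset v t1 z' = {}"
    using assms(1-3) unfolding coset_reps_def by blast
  with assms(4,5) show False by blast
qed

lemma coset_reps_exist:
  assumes "C \<subseteq> SL2" "\<And>g z. g \<in> Iw \<Longrightarrow> z \<in> C \<Longrightarrow> g ** z \<in> C"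
  shows "\<exists>Z. coset_reps v t1 C Z"
proof -
  \<comment> \<open>The choice depends only on the coset as a set.\<close>
  define rep where "rep z = (SOME y. y \<in> right_coset v t1 z)" for z
  have rep: "rep z \<in> right_coset v t1 z" for z
    unfolding rep_def by (rule someI[of _ z]) (rule right_coset_self)
  have in_C: "y \<in> C" if "y \<in> right_coset v t1 z" "z \<in> C" for y z
    using that assms(2) by (auto simp: right_coset_def)
  have eq: "right_coset v t1 y = right_coset v t1 z" if "y \<in> right_coset v t1 z" "z \<in> C" for y z
    using that right_coset_trans right_coset_sym[OF that(1)] assms(1) by blast
  have "C = (\<Union>z\<in>rep ` C. right_coset v t1 z)"
  proof (intro equalityI subsetI)
    show "x \<in> (\<Union>z\<in>rep ` C. right_coset v t1 z)" if "x \<in> C" for x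
      using eq[OF rep] right_coset_self that by blast
    show "x \<in> C" if "x \<in> (\<Union>z\<in>rep ` C. right_coset v t1 z)" for x
      using in_C rep that by blast
  qed
  moreover have "rep y = rep y'"
    if "y \<in> C" "y' \<in> C" "x \<in> right_coset v t1 (rep y)" "x \<in> right_coset v t1 (rep y')" for x y y'
  proof -
    have "right_coset v t1 y = right_coset v t1 y'"
      using that eq[OF rep] eq by metis
    thus ?thesis
      by (simp add: rep_def)
  qed
  ultimately have "coset_reps v t1 C (rep ` C)"
    unfolding coset_reps_def by blast
  thus ?thesis ..
qed

text \<open>
  Sending each representative in \<open>Z\<close> to the representative of its coset in \<open>Z'\<close> is a bijection that
  preserves the summand.
\<close>

lemma infsum_coset_reps:
  fixes f :: "'a ^ 2 ^ 2 \<Rightarrow> complex"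
  assumes Z: "coset_reps v t1 C Z" and Z': "coset_reps v t1 C Z'" and C: "C \<subseteq> SL2"
    and inv: "\<And>g z. g \<in> Iw \<Longrightarrow> z \<in> C \<Longrightarrow> f (g ** z) = f z"
  shows "infsum f Z = infsum f Z'"
proof -
  have "\<forall>z\<in>Z. \<exists>z'\<in>Z'. z \<in> right_coset v t1 z'"
    using coset_reps_subset[OF Z] Z' unfolding coset_reps_def by blast
  then obtain \<phi> where \<phi>: "\<And>z. z \<in> Z \<Longrightarrow> \<phi> z \<in> Z' \<and> z \<in> right_coset v t1 (\<phi> z)"
    by metis
  have "\<forall>z\<in>Z'. \<exists>z'\<in>Z. z \<in> right_coset v t1 z'"
    using coset_reps_subset[OF Z'] Z unfolding coset_reps_def by blast
  then obtain \<psi> where \<psi>: "\<And>z. z \<in> Z' \<Longrightarrow> \<psi> z \<in> Z \<and> z \<in> right_coset v t1 (\<psi> z)"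
    by metis
  note sub = coset_reps_subset[OF Z] coset_reps_subset[OF Z']
  have "\<psi> (\<phi> z) = z" if "z \<in> Z" for z
    using \<phi>[OF that] \<psi>[of "\<phi> z"] right_coset_sym[of z "\<phi> z"] sub C that
      coset_reps_unique[OF Z, of "\<psi> (\<phi> z)" z "\<phi> z"] by blast
  moreover have "\<phi> (\<psi> z) = z" if "z \<in> Z'" for z
    using \<psi>[OF that] \<phi>[of "\<psi> z"] right_coset_sym[of z "\<psi> z"] sub C that
      coset_reps_unique[OF Z', of "\<phi> (\<psi> z)" z "\<psi> z"] by blast
  ultimately have bij: "bij_betw \<phi> Z Z'"
    using \<phi> \<psi> by (intro bij_betw_byWitness[of _ \<psi>]) auto
  have "infsum f Z = infsum (\<lambda>z. f (\<phi> z)) Z"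
  proof (rule infsum_cong)
    fix z assume z: "z \<in> Z"
    then obtain g where "g \<in> Iw" "z = g ** \<phi> z"
      using \<phi>[OF z] by (auto simp: right_coset_def)
    thus "f z = f (\<phi> z)"
      using inv[of g "\<phi> z"] \<phi>[OF z] sub by (metis subsetD)
  qed
  also have "\<dots> = infsum f Z'"
    by (rule infsum_reindex_bij_betw[OF bij])
  finally show ?thesis .
qed

text \<open>
  Left multiplication by \<open>I\<close> changes neither the condition on \<open>z = g \<eta>\<^sub>\<kappa> h\<close> nor bounds on entries, so
  the bound on \<open>\<eta>\<^sub>\<kappa> h \<eta>\<^sub>\<kappa>\<^sup>-\<^sup>1\<close> carries over to \<open>z \<eta>\<^sub>\<kappa>\<^sup>-\<^sup>1\<close>.
\<close>

lemma finite_convolution_support: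
  assumes Z: "coset_reps v t1 (cl b k l) Z"
    and s: "s = j + l" "0 \<le> j * l" and eb: "e \<in> {1, 2}" "b \<in> {1, 2}"
  shows "finite {z \<in> Z. et e r s ** matrix_inv z \<in> cl a i j}"
proof (rule finite_if_entries_bounded)
  define N where "N = \<bar>i\<bar> + \<bar>r\<bar> + 2 * \<bar>k\<bar>"
  show "0 \<le> N"
    by (simp add: N_def)
  show "matrix_inv (et b k l) \<in> SL2"
    by (simp add: SL2_inv_closed eta_SL2)
  have cell: "z \<in> cl b k l" if "z \<in> Z" for z
    using coset_reps_subset[OF Z] that by blast
  thus "{z \<in> Z. et e r s ** matrix_inv z \<in> cl a i j} \<subseteq> SL2"
    using cell_SL2 by blast
  show "entries_in (- N) 0 (z ** matrix_inv (et b k l))"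
    if z: "z \<in> {z \<in> Z. et e r s ** matrix_inv z \<in> cl a i j}" for z
  proof -
    from z have "z \<in> cl b k l"
      using cell by blast
    then obtain g h where zgh: "z = g ** et b k l ** h" and g: "g \<in> Iw" and h: "h \<in> Iw"
      by (auto simp: cell_def)
    have "matrix_inv z = matrix_inv (et b k l ** h) ** matrix_inv g"
      using SL2_inv_mult[OF Iw_SL2[OF g] SL2_mult[OF eta_SL2 Iw_SL2[OF h]]]
      by (simp add: zgh matrix_mul_assoc)
    hence "et e r s ** matrix_inv (et b k l ** h) ** matrix_inv g \<in> cl a i j"
      using z by (simp add: matrix_mul_assoc)
    hence "et e r s ** matrix_inv (et b k l ** h) \<in> cl a i j"
      using cell_mult_right_iff[OF Iw_inv[OF g]] by blast
    from conjugate_entries_bounded[OF s eb h this]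
    have "entries_in (- N) 0 (et b k l ** h ** matrix_inv (et b k l))"
      by (simp add: N_def algebra_simps)
    from entries_in_mult[OF entries_in_Iw[OF g] this] show ?thesis
      by (simp add: zgh matrix_mul_assoc)
  qed
  show "z = z'"
    if "z \<in> {z \<in> Z. et e r s ** matrix_inv z \<in> cl a i j}"
      "z' \<in> {z \<in> Z. et e r s ** matrix_inv z \<in> cl a i j}" "z' ** matrix_inv z \<in> Iw" for z z'
  proof (rule coset_reps_unique[OF Z])
    show "z' \<in> right_coset v t1 z"
      using that cell_SL2[OF cell] by (simp add: mem_right_coset)
  qed (use that right_coset_self in auto)
qed

section \<open>The convolution product\<close>

lemma chi_nonzero: "chi v t1 t2 a i j y \<noteq> 0 \<longleftrightarrow> y \<in> cl a i j"
  by (simp add: chi_def indicator_def)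

lemma convolution_wrt_cong:
  assumes "coset_reps v t1 (cl b k l) Z" "coset_reps v t1 (cl b k l) Z'"
  shows "convolution_wrt v t1 t2 q a i j b k l Z x = convolution_wrt v t1 t2 q a i j b k l Z' x"
proof -
  have "(\<Sum>\<^sub>\<infinity>z\<in>Z. chi v t1 t2 a i j (y ** matrix_inv z)) =
      (\<Sum>\<^sub>\<infinity>z\<in>Z'. chi v t1 t2 a i j (y ** matrix_inv z))" for y
  proof (rule infsum_coset_reps[OF assms])
    show "cl b k l \<subseteq> SL2"
      using cell_SL2 by blast
    show "chi v t1 t2 a i j (y ** matrix_inv (g ** z)) = chi v t1 t2 a i j (y ** matrix_inv z)"
      if "g \<in> Iw" "z \<in> cl b k l" for g z
      using SL2_inv_mult[OF Iw_SL2[OF that(1)] cell_SL2[OF that(2)]]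
        cell_mult_right_iff[OF Iw_inv[OF that(1)], of "y ** matrix_inv z"]
      by (simp add: chi_def indicator_def matrix_mul_assoc)
  qed
  thus ?thesis
    by (simp add: convolution_wrt_def)
qed

lemma some_coset_reps:
  "coset_reps v t1 (cl b k l) (SOME Z. coset_reps v t1 (cl b k l) Z)"
proof (rule someI_ex, rule coset_reps_exist)
  show "cl b k l \<subseteq> SL2"
    using cell_SL2 by blast
qed (rule cell_mult_left)

lemma convolution_on_cell:
  assumes "x \<in> cl e r (j + l)" "e \<in> {1, 2}"
  shows "convolution v t1 t2 q a i j b k l x = convolution v t1 t2 q a i j b k l (et e r (j + l))"
proof -
  have "x \<in> level v t1 t2 (j + l)" "et e r (j + l) \<in> level v t1 t2 (j + l)"
    using assms eta_in_cell mem_level by blast+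
  thus ?thesis
    using eta_of_cell[OF assms] eta_of_cell[OF eta_in_cell assms(2)]
    by (simp add: convolution_def convolution_wrt_def)
qed

lemma convolution_nonzero:
  assumes "convolution v t1 t2 q a i j b k l (et e r (j + l)) \<noteq> 0" "e \<in> {1, 2}"
  shows "0 \<le> j * l"
    and "tpow r (j + l) \<in> frac_ideal (- \<bar>i\<bar> - \<bar>k\<bar>) (- \<bar>j\<bar> - \<bar>l\<bar>)"
    and "tpow (- r) (- (j + l)) \<in> frac_ideal (- \<bar>i\<bar> - \<bar>k\<bar>) (- \<bar>j\<bar> - \<bar>l\<bar>)"
proof -
  define Z where "Z = (SOME Z. coset_reps v t1 (cl b k l) Z)"
  have Z: "coset_reps v t1 (cl b k l) Z"
    unfolding Z_def by (rule some_coset_reps)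
  note eta_of = eta_of_cell[OF eta_in_cell assms(2)]
  show "0 \<le> j * l"
    using assms(1) by (auto simp: convolution_def convolution_wrt_def split: if_splits)
  have "(\<Sum>\<^sub>\<infinity>z\<in>Z. chi v t1 t2 a i j (et e r (j + l) ** matrix_inv z)) \<noteq> 0"
    using assms(1)
    by (auto simp: convolution_def convolution_wrt_def eta_of Z_def[symmetric] split: if_splits)
  then obtain z where "z \<in> Z" "chi v t1 t2 a i j (et e r (j + l) ** matrix_inv z) \<noteq> 0"
    using infsum_0 by metis
  hence "et e r (j + l) ** matrix_inv z \<in> cl a i j" "z \<in> cl b k l"
    using coset_reps_subset[OF Z] by (auto simp: chi_nonzero)
  from eta_in_product_range[OF this]
  show "tpow r (j + l) \<in> frac_ideal (- \<bar>i\<bar> - \<bar>k\<bar>) (- \<bar>j\<bar> - \<bar>l\<bar>)"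
    "tpow (- r) (- (j + l)) \<in> frac_ideal (- \<bar>i\<bar> - \<bar>k\<bar>) (- \<bar>j\<bar> - \<bar>l\<bar>)" .
qed

text \<open>
  The convolution is constant on the cells of level \<open>j + l\<close> and vanishes elsewhere, and of the
  characteristic functions of cells at most one is nonzero at a given point.
\<close>

lemma convolution_expansion:
  fixes A :: "int set" and a b q :: nat and i j k l :: int
  defines "c \<equiv> \<lambda>e r. convolution v t1 t2 q a i j b k l (et e r (j + l))"
  assumes supp: "\<And>e r. e \<in> {1, 2} \<Longrightarrow> c e r \<noteq> 0 \<Longrightarrow> r \<in> A"
  shows "convolution v t1 t2 q a i j b k l x =
    (\<Sum>e\<in>{1, 2}. \<Sum>\<^sub>\<infinity>r\<in>A. c e r * chi v t1 t2 e r (j + l) x)"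
proof (cases "x \<in> level v t1 t2 (j + l)")
  case True
  then obtain e0 r0 where x: "e0 \<in> {1, 2}" "x \<in> cl e0 r0 (j + l)"
    using mem_level by blast
  have chi_x: "chi v t1 t2 e r (j + l) x = (if e = e0 \<and> r = r0 then 1 else 0)"
    if "e \<in> {1, 2}" for e r
  proof (cases "e = e0 \<and> r = r0")
    case False
    hence "x \<notin> cl e r (j + l)"
      using cell_unique[OF x(2) _ x(1) that] by blast
    thus ?thesis
      using False by (simp add: chi_def)
  qed (use x(2) in \<open>simp add: chi_def\<close>)
  have "(\<Sum>\<^sub>\<infinity>r\<in>A. c e r * chi v t1 t2 e r (j + l) x) = (if e = e0 then c e0 r0 else 0)"
    if e: "e \<in> {1, 2}" for e
  proof -
    have "(\<Sum>\<^sub>\<infinity>r\<in>A. c e r * chi v t1 t2 e r (j + l) x) =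
        (\<Sum>\<^sub>\<infinity>r\<in>{r0}. if e = e0 then c e0 r0 else 0)"
      using supp[OF x(1), of r0] by (intro infsum_cong_neutral) (auto simp: chi_x[OF e])
    thus ?thesis by simp
  qed
  hence "(\<Sum>e\<in>{1, 2}. \<Sum>\<^sub>\<infinity>r\<in>A. c e r * chi v t1 t2 e r (j + l) x) =
      (\<Sum>e\<in>{1, 2}. if e = e0 then c e0 r0 else 0)"
    by (intro sum.cong refl)
  also have "\<dots> = c e0 r0"
    using x(1) by auto
  also have "\<dots> = convolution v t1 t2 q a i j b k l x"
    unfolding c_def by (rule convolution_on_cell[OF x(2,1), symmetric])
  finally show ?thesis ..
next
  case False
  hence "x \<notin> cl e r (j + l)" if "e \<in> {1, 2}" for e r
    using that mem_level by blast
  thus ?thesis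
    using False by (simp add: chi_def convolution_def convolution_wrt_def)
qed

end

lemma (in two_dim_local_field) iwahori_settingI:
  assumes "t1 \<noteq> 0" "v t1 = (1, 0)" "t2 \<noteq> 0" "v t2 = (0, 1)"
  shows "iwahori_setting v t1 t2"
proof -
  interpret rank_two_valued_field v
    using rank_two by unfold_locales
  show ?thesis
    using assms finite_residue
    by unfold_locales (simp_all only: integers_def frac_ideal_def mem_Collect_eq not_False_eq_True)
qed

theorem theorem2p7:
  fixes v :: "'a::field \<Rightarrow> int \<times> int" and w2 :: "'a \<Rightarrow> int" and w1 :: "'a set \<Rightarrow> int"
    and q :: nat and t1 t2 :: 'a and a b :: nat and i j k l :: int
  assumes "two_dim_local_field v w2 w1 q"
    and "t1 \<noteq> 0" and "v t1 = (1, 0)"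
    and "t2 \<noteq> 0" and "v t2 = (0, 1)"
    and "a \<in> {1, 2}" and "b \<in> {1, 2}"
  shows
    "(\<forall>Z. coset_reps v t1 (cell v t1 t2 b k l) Z \<longrightarrow>
        (\<forall>x\<in>SL2. x \<in> level v t1 t2 (j + l) \<and> 0 \<le> j * l \<longrightarrow>
           finite {z \<in> Z. chi v t1 t2 a i j (eta_of v t1 t2 x ** matrix_inv z) \<noteq> 0}) \<and>
        (\<forall>x\<in>SL2. convolution_wrt v t1 t2 q a i j b k l Z x =
           convolution v t1 t2 q a i j b k l x)) \<and>
     ((\<exists>s>0. \<exists>n. \<exists>c :: nat \<Rightarrow> int \<Rightarrow> complex. \<forall>x\<in>SL2.
         convolution v t1 t2 q a i j b k l x =
           (\<Sum>e\<in>{1, 2}. \<Sum>\<^sub>\<infinity>r\<in>{..n}. c e r * chi v t1 t2 e r s x)) \<or>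
      (\<exists>s<0. \<exists>n. \<exists>c :: nat \<Rightarrow> int \<Rightarrow> complex. \<forall>x\<in>SL2.
         convolution v t1 t2 q a i j b k l x =
           (\<Sum>e\<in>{1, 2}. \<Sum>\<^sub>\<infinity>r\<in>{n..}. c e r * chi v t1 t2 e r s x)) \<or>
      (\<exists>n n'. \<exists>c :: nat \<Rightarrow> int \<Rightarrow> complex. \<forall>x\<in>SL2.
         convolution v t1 t2 q a i j b k l x =
           (\<Sum>e\<in>{1, 2}. \<Sum>r\<in>{n..n'}. c e r * chi v t1 t2 e r 0 x)))"
    (is "?well_defined \<and> (?pos \<or> ?neg \<or> ?zero)")
proof -
  interpret iwahori_setting v t1 t2
    using assms(1-5) by (rule two_dim_local_field.iwahori_settingI)
  have ?well_defined
  proof (intro allI impI conjI ballI)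
    fix Z x
    assume Z: "coset_reps v t1 (cell v t1 t2 b k l) Z"
    show "convolution_wrt v t1 t2 q a i j b k l Z x = convolution v t1 t2 q a i j b k l x"
      unfolding convolution_def by (rule convolution_wrt_cong[OF Z some_coset_reps])
    assume x: "x \<in> level v t1 t2 (j + l) \<and> 0 \<le> j * l"
    then obtain e r where "e \<in> {1, 2}" "x \<in> cl e r (j + l)"
      using mem_level by blast
    thus "finite {z \<in> Z. chi v t1 t2 a i j (eta_of v t1 t2 x ** matrix_inv z) \<noteq> 0}"
      using finite_convolution_support[OF Z refl _ _ assms(7)] x
      by (simp add: eta_of_cell chi_nonzero)
  qed
  moreover have "?pos \<or> ?neg \<or> ?zero"
  proof -
    define c where "c e r = convolution v t1 t2 q a i j b k l (et e r (j + l))" for e r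
    define n where "n = \<bar>i\<bar> + \<bar>k\<bar>"
    have exp: "convolution v t1 t2 q a i j b k l x =
        (\<Sum>e\<in>{1, 2}. \<Sum>\<^sub>\<infinity>r\<in>A. c e r * chi v t1 t2 e r (j + l) x)"
      if "\<And>e r. e \<in> {1, 2} \<Longrightarrow> c e r \<noteq> 0 \<Longrightarrow> r \<in> A" for A x
      unfolding c_def by (rule convolution_expansion) (use that in \<open>simp add: c_def\<close>)
    note nonzero = convolution_nonzero[of q a i j b k l, folded c_def, unfolded tpow_mem_frac]
    have "j = 0 \<and> l = 0" if "0 \<le> j * l" "j + l = 0"
      using that by (auto simp: zero_le_mult_iff)
    then consider "j * l < 0" | "0 < j + l" | "j + l < 0" | "j = 0" "l = 0"
      by (metis linorder_neqE_linordered_idom not_less)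
    thus ?thesis
    proof cases
      \<comment> \<open>The product is zero by definition, and the zero function is of all three types.\<close>
      case 1
      hence "convolution v t1 t2 q a i j b k l x = 0" for x
        by (simp add: convolution_def convolution_wrt_def)
      hence ?zero
        by (intro exI[of _ 0] exI[of _ "\<lambda>_ _. 0"]) simp
      thus ?thesis by blast
    next
      case 2
      have "r \<in> {..n}" if "e \<in> {1, 2}" "c e r \<noteq> 0" for e r
        using nonzero[OF that(2,1)] 2 by (auto simp: n_def zero_le_mult_iff)
      with exp 2 have ?pos by blast
      thus ?thesis by blast
    next
      case 3
      have "r \<in> {- n..}" if "e \<in> {1, 2}" "c e r \<noteq> 0" for e r
        using nonzero[OF that(2,1)] 3 by (auto simp: n_def zero_le_mult_iff)
      with exp 3 have ?neg by blast
      thus ?thesis by blast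
    next
      case 4
      have "r \<in> {- n..n}" if "e \<in> {1, 2}" "c e r \<noteq> 0" for e r
        using nonzero[OF that(2,1)] 4 by (auto simp: n_def)
      hence "convolution v t1 t2 q a i j b k l x =
          (\<Sum>e\<in>{1, 2}. \<Sum>r\<in>{- n..n}. c e r * chi v t1 t2 e r 0 x)" for x
        using exp[of "{- n..n}" x] 4 by simp
      hence ?zero by blast
      thus ?thesis by blast
    qed
  qed
  ultimately show ?thesis ..
qed

end
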